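(* Let $B$ be a ring of prime characteristic $p$, $D$ a derivation of $B$, and let $f=X^{p^e}+X^{p^{e-1}}b_e+\cdots+X^pb_{2}+Xb_1+b_0$ ($e\ge 1$) be in $B[X;D]_{(0)}$. Then $f$ is weakly separable in $B[X;D]$ if and only if $$\{ g \in V \mid \tau(g)=0 \} = \tilde{D}(V).$$
   Context: Rings are associative with identity, not necessarily commutative. A derivation of $B$ is an additive map $D:B\to B$ with $D(\alpha\beta)=D(\alpha)\beta+\alpha D(\beta)$. $B[X;D]$ is the skew polynomial ring whose elements are $\sum_jX^jc_j$ ($c_j\in B$), with multiplication determined by $\alpha X=X\alpha+D(\alpha)$ for $\alpha\in B$. $B[X;D]_{(0)}$ is the set of all monic $g\in B[X;D]$ with $gB[X;D]=B[X;D]g$. Put $b_{e+1}=1$, so $f=\sum_{j=0}^{e}X^{p^j}b_{j+1}+b_0$. Set $A=B[X;D]/fB[X;D]$, a ring extension of $B$ that is free with basis $1,x,\dots,x^{p^e-1}$, where $x=X+fB[X;D]$. For such $f\in B[X;D]_{(0)}$ the coefficients of $f$ are all killed by $D$, so $D$ induces a derivation $\tilde D$ of $A$ given by $\tilde D(\sum_{j=0}^{p^e-1}x^jc_j)=\sum_{j=0}^{p^e-1}x^jD(c_j)$. Let $V=V_A(B)$ be the centralizer of $B$ in $A$, $\tilde D(V)=\{\tilde D(h)\mid h\in V\}$, and $V^{\tilde D}=\{v\in V\mid\tilde D(v)=0\}$. The map $\tau:V\to V^{\tilde D}$ is $$\tau(h)=\sum_{j=0}^{e}\tilde D^{\,p^j-1}(h)\,b_{j+1}=\tilde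 D^{\,p^e-1}(h)+\tilde D^{\,p^{e-1}-1}(h)b_e+\cdots+\tilde D^{\,p-1}(h)b_2+hb_1.$$ A $B$-derivation of $A$ is an additive map $\delta:A\to A$ with $\delta(yz)=\delta(y)z+y\delta(z)$ for all $y,z\in A$ and $\delta(\alpha)=0$ for all $\alpha\in B$; it is inner if there is $u\in A$ with $\delta(y)=uy-yu$ for all $y\in A$. $A/B$ is weakly separable if every $B$-derivation of $A$ to $A$ is inner. The polynomial $f$ is weakly separable in $B[X;D]$ if $A$ is weakly separable over $B$. *)

theory Defs
  imports "HOL-Computational_Algebra.Polynomial" "HOL-Computational_Algebra.Primes"
    "HOL-Algebra.QuotRing"
begin

section \<open>Skew polynomial rings of derivation type\<close>

definition derivation :: "('a::ring_1 \<Rightarrow> 'a) \<Rightarrow> bool" where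
  "derivation D \<longleftrightarrow>
     (\<forall>a b. D (a + b) = D a + D b) \<and> (\<forall>a b. D (a * b) = D a * b + a * D b)"

text \<open>
  Elements of \<open>B[X;D]\<close> are represented by the type \<^typ>\<open>'a poly\<close>, used only as the additive group
  of finitely supported coefficient sequences: \<open>p\<close> stands for \<open>\<Sum>j. X\<^sup>j c\<^sub>j\<close> with
  \<open>c\<^sub>j = coeff p j\<close> written on the right of the powers of \<open>X\<close>.  The library multiplication of
  polynomials is not used (it is not even available over a noncommutative ring).

  Since \<open>c X = X c + D c\<close>, right multiplication by \<open>X\<close> sends \<open>\<Sum>j. X\<^sup>j c\<^sub>j\<close> to
  \<open>\<Sum>j. X\<^sup>j\<^sup>+\<^sup>1 c\<^sub>j + \<Sum>j. X\<^sup>j D c\<^sub>j\<close>.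
\<close>

definition times_X :: "('a::ring_1 \<Rightarrow> 'a) \<Rightarrow> 'a poly \<Rightarrow> 'a poly" where
  "times_X D p = pCons 0 p + map_poly D p"

definition times_const :: "'a::ring_1 poly \<Rightarrow> 'a \<Rightarrow> 'a poly" where
  "times_const p c = map_poly (\<lambda>a. a * c) p"

text \<open>\<open>p \<cdot> (\<Sum>j. X\<^sup>j c\<^sub>j) = \<Sum>j. (p X\<^sup>j) c\<^sub>j\<close>\<close>

definition skew_mult :: "('a::ring_1 \<Rightarrow> 'a) \<Rightarrow> 'a poly \<Rightarrow> 'a poly \<Rightarrow> 'a poly" where
  "skew_mult D p q = (\<Sum>j\<le>degree q. times_const ((times_X D ^^ j) p) (coeff q j))"

definition skew_poly_ring :: "('a::ring_1 \<Rightarrow> 'a) \<Rightarrow> 'a poly ring" where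
  "skew_poly_ring D =
     \<lparr>carrier = UNIV, mult = skew_mult D, one = [:1:], zero = 0, add = (+)\<rparr>"

definition skew_poly_ring_0 :: "('a::ring_1 \<Rightarrow> 'a) \<Rightarrow> 'a poly set" where
  "skew_poly_ring_0 D =
     {g. lead_coeff g = 1 \<and>
         g <#\<^bsub>skew_poly_ring D\<^esub> carrier (skew_poly_ring D)
           = carrier (skew_poly_ring D) #>\<^bsub>skew_poly_ring D\<^esub> g}"


subsection \<open>Ring axioms and the commutation rule\<close>

lemma derivation_0: "derivation D \<Longrightarrow> D 0 = 0"
  unfolding derivation_def by (metis add_cancel_right_left)

lemma coeff_times_const [simp]: "coeff (times_const p c) n = coeff p n * c"
  by (simp add: times_const_def coeff_map_poly)

lemma times_const_add: "times_const (p + q) c = times_const p c + times_const q c"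
  by (rule poly_eqI) (simp add: distrib_right)

lemma times_const_add_right: "times_const p (c + d) = times_const p c + times_const p d"
  by (rule poly_eqI) (simp add: distrib_left)

lemma times_const_times_const: "times_const (times_const p c) d = times_const p (c * d)"
  by (rule poly_eqI) (simp add: mult.assoc)

lemma times_const_0 [simp]: "times_const p 0 = 0" "times_const 0 c = 0"
  by (auto intro: poly_eqI)

lemma times_const_1 [simp]: "times_const p 1 = p"
  by (rule poly_eqI) simp

lemma times_const_sum: "times_const (\<Sum>i\<in>I. f i) c = (\<Sum>i\<in>I. times_const (f i) c)"
  by (rule poly_eqI) (simp add: coeff_sum sum_distrib_right)

lemma skew_mult_bound:
  assumes "degree q \<le> n"
  shows "skew_mult D p q = (\<Sum>j\<le>n. times_const ((times_X D ^^ j) p) (coeff q j))"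
  unfolding skew_mult_def using assms
  by (intro sum.mono_neutral_left) (auto simp: coeff_eq_0)

lemma skew_mult_add_right: "skew_mult D p (q + r) = skew_mult D p q + skew_mult D p r"
proof -
  let ?n = "max (degree q) (degree r)"
  have "degree (q + r) \<le> ?n" by (rule degree_add_le_max)
  then show ?thesis
    by (simp add: skew_mult_bound[of _ ?n] times_const_add_right sum.distrib)
qed

lemma skew_mult_0_right [simp]: "skew_mult D p 0 = 0"
  by (simp add: skew_mult_def)

lemma skew_mult_sum_right: "skew_mult D p (\<Sum>i\<in>I. f i) = (\<Sum>i\<in>I. skew_mult D p (f i))"
  by (induction I rule: infinite_finite_induct) (simp_all add: skew_mult_add_right)

lemma skew_mult_times_const:
  "skew_mult D p (times_const q c) = times_const (skew_mult D p q) c"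
proof -
  have "degree (times_const q c) \<le> degree q"
    by (rule degree_le) (simp add: coeff_eq_0)
  then show ?thesis
    by (simp add: skew_mult_bound[of _ "degree q"] times_const_sum times_const_times_const)
qed

context
  fixes D :: "'a::ring_1 \<Rightarrow> 'a"
  assumes D: "derivation D"
begin

lemma coeff_map_D: "coeff (map_poly D p) n = D (coeff p n)"
  by (simp add: coeff_map_poly derivation_0[OF D])

lemma times_X_add: "times_X D (p + q) = times_X D p + times_X D q"
  using D unfolding times_X_def
  by (intro poly_eqI) (auto simp: coeff_map_D derivation_def coeff_pCons split: nat.splits)

lemma times_X_0 [simp]: "times_X D 0 = 0"
  by (simp add: times_X_def)

lemma times_X_sum: "times_X D (\<Sum>i\<in>I. f i) = (\<Sum>i\<in>I. times_X D (f i))"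
  by (induction I rule: infinite_finite_induct) (simp_all add: times_X_add)

lemma times_X_times_const:
  "times_X D (times_const p c) = times_const (times_X D p) c + times_const p (D c)"
  using D unfolding times_X_def
  by (intro poly_eqI)
     (auto simp: coeff_map_D derivation_def coeff_pCons distrib_right split: nat.splits)

lemma times_X_pow_add: "(times_X D ^^ j) (p + q) = (times_X D ^^ j) p + (times_X D ^^ j) q"
  by (induction j) (simp_all add: times_X_add)

lemma skew_mult_add_left: "skew_mult D (p + q) r = skew_mult D p r + skew_mult D q r"
  by (simp add: skew_mult_def times_X_pow_add times_const_add sum.distrib)

lemma skew_mult_times_X: "skew_mult D p (times_X D q) = times_X D (skew_mult D p q)"
proof -
  let ?n = "degree q" and ?T = "\<lambda>j. (times_X D ^^ j) p"
  have deg1: "degree (pCons 0 q) \<le> Suc ?n" by (rule degree_pCons_le)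
  have deg2: "degree (map_poly D q) \<le> ?n"
    by (rule degree_le) (simp add: coeff_map_D coeff_eq_0 derivation_0[OF D])
  have "skew_mult D p (times_X D q)
      = (\<Sum>j\<le>?n. times_const (?T (Suc j)) (coeff q j)) + (\<Sum>j\<le>?n. times_const (?T j) (D (coeff q j)))"
    unfolding times_X_def[of D q] skew_mult_add_right skew_mult_bound[OF deg1]
      skew_mult_bound[OF deg2]
    by (subst sum.atMost_Suc_shift) (simp add: coeff_map_D)
  also have "\<dots> = times_X D (skew_mult D p q)"
    by (simp add: skew_mult_def times_X_sum times_X_times_const sum.distrib)
  finally show ?thesis .
qed

lemma skew_mult_times_X_pow:
  "skew_mult D p ((times_X D ^^ j) q) = (times_X D ^^ j) (skew_mult D p q)"
  by (induction j) (simp_all add: skew_mult_times_X)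

lemma skew_mult_assoc: "skew_mult D (skew_mult D p q) r = skew_mult D p (skew_mult D q r)"
  by (simp add: skew_mult_def[of _ _ r] skew_mult_sum_right skew_mult_times_const
      skew_mult_times_X_pow)

lemma times_X_pow_one: "(times_X D ^^ j) [:1:] = monom 1 j"
proof (induction j)
  case 0
  show ?case by (simp add: monom_0)
next
  case (Suc j)
  have "D 1 = 0"
    using D unfolding derivation_def by (metis add_cancel_right_left mult.right_neutral mult_1)
  then have "map_poly D (monom 1 j) = 0"
    by (intro poly_eqI) (simp add: coeff_map_D derivation_0[OF D])
  with Suc show ?case by (simp add: times_X_def monom_Suc)
qed

theorem ring_skew_poly_ring: "ring (skew_poly_ring D)"
proof (intro ringI abelian_groupI monoidI)
  fix p assume "p \<in> carrier (skew_poly_ring D)"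
  show "\<one>\<^bsub>skew_poly_ring D\<^esub> \<otimes>\<^bsub>skew_poly_ring D\<^esub> p = p"
  proof (simp add: skew_poly_ring_def skew_mult_def times_X_pow_one, rule poly_eqI)
    fix n
    show "coeff (\<Sum>j\<le>degree p. times_const (monom 1 j) (coeff p j)) n = coeff p n"
      by (simp add: coeff_sum if_distrib[of "\<lambda>x. x * _"] coeff_eq_0 cong: if_cong)
  qed
  show "p \<otimes>\<^bsub>skew_poly_ring D\<^esub> \<one>\<^bsub>skew_poly_ring D\<^esub> = p"
    by (simp add: skew_poly_ring_def skew_mult_def)
  show "\<exists>q\<in>carrier (skew_poly_ring D). q \<oplus>\<^bsub>skew_poly_ring D\<^esub> p = \<zero>\<^bsub>skew_poly_ring D\<^esub>"
    by (auto simp: skew_poly_ring_def intro: exI[of _ "- p"])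
qed (simp_all add: skew_poly_ring_def skew_mult_add_left skew_mult_add_right skew_mult_assoc
       add_ac)

lemma skew_commutation: "skew_mult D [:c:] (monom 1 1) = monom c 1 + [:D c:]"
  by (simp add: skew_mult_def times_X_def degree_monom_eq map_poly_pCons derivation_0[OF D]
      monom_Suc monom_0)

lemma skew_mult_monom_const: "skew_mult D (monom 1 j) [:c:] = monom c j"
  by (rule poly_eqI) (simp add: skew_mult_def)

end


section \<open>Weak separability\<close>

definition centralizer :: "('r, 'm) ring_scheme \<Rightarrow> 'r set \<Rightarrow> 'r set" where
  "centralizer A S = {v \<in> carrier A. \<forall>s\<in>S. v \<otimes>\<^bsub>A\<^esub> s = s \<otimes>\<^bsub>A\<^esub> v}"

definition relative_derivation :: "('r, 'm) ring_scheme \<Rightarrow> 'r set \<Rightarrow> ('r \<Rightarrow> 'r) \<Rightarrow> bool" where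
  "relative_derivation A S \<delta> \<longleftrightarrow>
     \<delta> \<in> carrier A \<rightarrow> carrier A \<and>
     (\<forall>y\<in>carrier A. \<forall>z\<in>carrier A. \<delta> (y \<oplus>\<^bsub>A\<^esub> z) = \<delta> y \<oplus>\<^bsub>A\<^esub> \<delta> z) \<and>
     (\<forall>y\<in>carrier A. \<forall>z\<in>carrier A. \<delta> (y \<otimes>\<^bsub>A\<^esub> z) = \<delta> y \<otimes>\<^bsub>A\<^esub> z \<oplus>\<^bsub>A\<^esub> y \<otimes>\<^bsub>A\<^esub> \<delta> z) \<and>
     (\<forall>s\<in>S. \<delta> s = \<zero>\<^bsub>A\<^esub>)"

definition inner_derivation :: "('r, 'm) ring_scheme \<Rightarrow> ('r \<Rightarrow> 'r) \<Rightarrow> bool" where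
  "inner_derivation A \<delta> \<longleftrightarrow>
     (\<exists>u\<in>carrier A. \<forall>y\<in>carrier A. \<delta> y = u \<otimes>\<^bsub>A\<^esub> y \<ominus>\<^bsub>A\<^esub> y \<otimes>\<^bsub>A\<^esub> u)"

definition weakly_separable_ext :: "('r, 'm) ring_scheme \<Rightarrow> 'r set \<Rightarrow> bool" where
  "weakly_separable_ext A S \<longleftrightarrow> (\<forall>\<delta>. relative_derivation A S \<delta> \<longrightarrow> inner_derivation A \<delta>)"


section \<open>The extension of \<open>B\<close> defined by \<open>f\<close>\<close>

text \<open>
  The right ideal \<open>f B[X;D]\<close> is two-sided, and hence the quotient is a ring, whenever
  \<open>f \<in> B[X;D]\<^sub>(\<^sub>0\<^sub>)\<close>.
\<close>

definition skew_ideal :: "('a::ring_1 \<Rightarrow> 'a) \<Rightarrow> 'a poly \<Rightarrow> 'a poly set" where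
  "skew_ideal D f = f <#\<^bsub>skew_poly_ring D\<^esub> carrier (skew_poly_ring D)"

definition skew_ext :: "('a::ring_1 \<Rightarrow> 'a) \<Rightarrow> 'a poly \<Rightarrow> 'a poly set ring" where
  "skew_ext D f = skew_poly_ring D Quot skew_ideal D f"

definition skew_class :: "('a::ring_1 \<Rightarrow> 'a) \<Rightarrow> 'a poly \<Rightarrow> 'a poly \<Rightarrow> 'a poly set" where
  "skew_class D f p = skew_ideal D f +>\<^bsub>skew_poly_ring D\<^esub> p"

abbreviation base_emb :: "('a::ring_1 \<Rightarrow> 'a) \<Rightarrow> 'a poly \<Rightarrow> 'a \<Rightarrow> 'a poly set" where
  "base_emb D f c \<equiv> skew_class D f [:c:]"

definition base_centralizer :: "('a::ring_1 \<Rightarrow> 'a) \<Rightarrow> 'a poly \<Rightarrow> 'a poly set set" where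
  "base_centralizer D f = centralizer (skew_ext D f) (range (base_emb D f))"

definition weakly_separable_poly :: "('a::ring_1 \<Rightarrow> 'a) \<Rightarrow> 'a poly \<Rightarrow> bool" where
  "weakly_separable_poly D f \<longleftrightarrow> weakly_separable_ext (skew_ext D f) (range (base_emb D f))"

text \<open>
  As \<open>f\<close> is monic, \<open>1, x, \<dots>, x\<^sup>n\<^sup>-\<^sup>1\<close> with \<open>n = degree f\<close> is a basis of the quotient: every coset
  \<open>a\<close> contains exactly one polynomial \<open>\<Sum>j<n. X\<^sup>j c\<^sub>j\<close>, and \<open>a = \<Sum>j<n. x\<^sup>j c\<^sub>j\<close>.  The induced
  derivation applies \<open>D\<close> to these \<open>c\<^sub>j\<close>.
\<close>

definition induced_deriv :: "('a::ring_1 \<Rightarrow> 'a) \<Rightarrow> 'a poly \<Rightarrow> 'a poly set \<Rightarrow> 'a poly set" where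
  "induced_deriv D f a = skew_class D f (map_poly D (THE r. r \<in> a \<and> degree r < degree f))"

text \<open>
  The polynomial \<open>X\<^bsup>p^e\<^esup> b\<^sub>e\<^sub>+\<^sub>1 + \<dots> + X\<^sup>p b\<^sub>2 + X b\<^sub>1 + b\<^sub>0\<close>; it is monic if \<open>b\<^sub>e\<^sub>+\<^sub>1 = 1\<close>.
\<close>

definition p_poly :: "nat \<Rightarrow> nat \<Rightarrow> (nat \<Rightarrow> 'a::ring_1) \<Rightarrow> 'a poly" where
  "p_poly p e b = (\<Sum>j\<le>e. monom (b (j + 1)) (p ^ j)) + [:b 0:]"

definition tau :: "('a::ring_1 \<Rightarrow> 'a) \<Rightarrow> nat \<Rightarrow> nat \<Rightarrow> (nat \<Rightarrow> 'a) \<Rightarrow> 'a poly set \<Rightarrow> 'a poly set" where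
  "tau D p e b h =
     (let f = p_poly p e b; A = skew_ext D f
      in \<Oplus>\<^bsub>A\<^esub>j\<in>{..e}. (induced_deriv D f ^^ (p ^ j - 1)) h \<otimes>\<^bsub>A\<^esub> base_emb D f (b (j + 1)))"

end

theory Submission
  imports Defs
begin

text \<open>
  A \<open>B\<close>-derivation \<open>\<delta>\<close> of \<open>A\<close> is determined by \<open>u = \<delta>(x)\<close>, so the theorem compares two sets of
  possible values \<open>u\<close>: those of all \<open>B\<close>-derivations and those of the inner ones.

  Applying \<open>\<delta>\<close> to \<open>\<alpha>x = x\<alpha> + D(\<alpha>)\<close> gives \<open>\<alpha>u = u\<alpha>\<close>, so \<open>u \<in> V\<close>.  Conversely every \<open>u \<in> V\<close> gives a
  derivation \<open>\<Delta>\<^sub>u\<close> from \<open>B[X;D]\<close> to \<open>A\<close> vanishing on \<open>B\<close> and sending \<open>X\<close> to \<open>u\<close>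
  (\<open>formal_deriv_mult\<close>), and it factors through \<open>A\<close> exactly if \<open>\<Delta>\<^sub>u(f) = 0\<close>.  Thus the values \<open>\<delta>(x)\<close> are
  the \<open>u \<in> V\<close> with \<open>\<Delta>\<^sub>u(f) = 0\<close> (\<open>derivation_values_at_X\<close>).

  The induced derivation is itself a commutator: \<open>gX - Xg\<close> is \<open>D\<close> applied to the coefficients of \<open>g\<close>
  (\<open>map_poly_D_eq\<close>), hence \<open>D~(h) = hx - xh\<close>.  So the inner derivation by \<open>h\<close>, which vanishes on \<open>B\<close>
  precisely for \<open>h \<in> V\<close>, has the value \<open>D~(h)\<close> at \<open>x\<close>, and the inner derivations account for the
  values in \<open>D~(V)\<close> (\<open>inner_derivation_iff\<close>).

  What links \<open>\<Delta>\<^sub>u(f)\<close> with \<open>\<tau>(u)\<close> is the characteristic.  With \<open>L\<close> and \<open>R\<close> the left and right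
  multiplications by \<open>X\<close>, and \<open>q\<close> a power of \<open>p\<close>, one has
  \<open>\<Delta>\<^sub>u(X\<^sup>q) = \<Sum>i<q. X\<^sup>i u X\<^bsup>q-1-i\<^esup> = (R - L)\<^bsup>q-1\<^esup>(u) = D~\<^bsup>q-1\<^esup>(u)\<close> (\<open>power_deriv_prime_power\<close>).  Since \<open>f\<close>
  involves only such powers of \<open>X\<close> and a constant, \<open>\<Delta>\<^sub>u(f) = \<tau>(u)\<close> (\<open>tau_cls\<close>).

  The calculations take place on representatives in \<open>B[X;D]\<close>, where addition is that of the type
  \<^typ>\<open>'a poly\<close>, and are transported to \<open>A\<close> by the residue class map.
\<close>

section \<open>Differentiating a skew polynomial\<close>

locale skew_polynomials =
  fixes D :: "'a::ring_1 \<Rightarrow> 'a"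
  assumes derivation: "derivation D"
begin

abbreviation smult :: "'a poly \<Rightarrow> 'a poly \<Rightarrow> 'a poly" (infixl "\<star>" 70) where
  "g \<star> h \<equiv> skew_mult D g h"

abbreviation X :: "'a poly" where
  "X \<equiv> monom 1 (Suc 0)"

lemma D_of_nat: "D (of_nat n) = 0"
proof (induction n)
  case (Suc n)
  have "D (1 * 1) = D 1 * 1 + 1 * D 1"
    using derivation unfolding derivation_def by blast
  then have "D 1 = 0" by simp
  with Suc show ?case
    using derivation by (simp add: derivation_def)
qed (simp add: derivation_0[OF derivation])

lemma ring_R: "ring (skew_poly_ring D)"
  by (rule ring_skew_poly_ring[OF derivation])

lemma skew_mult_one_left [simp]: "[:1:] \<star> g = g"
  using ring.ring_simprules(12)[OF ring_R, of g] by (simp add: skew_poly_ring_def)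

lemma skew_mult_one_right [simp]: "g \<star> [:1:] = g"
  by (simp add: skew_mult_def)

lemma skew_mult_const_right: "g \<star> [:c:] = times_const g c"
  by (simp add: skew_mult_def)

lemmas skew_assoc = skew_mult_assoc[OF derivation]

lemma skew_mult_0_left [simp]: "0 \<star> g = 0"
  using skew_mult_add_left[OF derivation, of 0 0 g] by simp

lemma skew_mult_uminus_left: "(- g) \<star> h = - (g \<star> h)"
  using skew_mult_add_left[OF derivation, of "-g" g h] by (simp add: eq_neg_iff_add_eq_0)

lemma skew_mult_uminus_right: "g \<star> (- h) = - (g \<star> h)"
  using skew_mult_add_right[of D g "-h" h] by (simp add: eq_neg_iff_add_eq_0)

lemma skew_mult_diff_right: "g \<star> (h - k) = g \<star> h - g \<star> k"
  using skew_mult_add_right[of D g h "-k"] by (simp add: skew_mult_uminus_right)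

lemma skew_mult_diff_left: "(h - k) \<star> g = h \<star> g - k \<star> g"
  using skew_mult_add_left[OF derivation, of h "-k" g] by (simp add: skew_mult_uminus_left)

lemma sum_skew_mult: "(\<Sum>k\<in>K. h k) \<star> g = (\<Sum>k\<in>K. h k \<star> g)"
  by (induction K rule: infinite_finite_induct) (simp_all add: skew_mult_add_left[OF derivation])

lemma times_X_eq: "times_X D g = g \<star> X"
  using skew_mult_times_X[OF derivation, of g "[:1:]"] times_X_pow_one[OF derivation, of 1] by simp

lemma times_X_pow_eq: "(times_X D ^^ j) g = g \<star> monom 1 j"
  using skew_mult_times_X_pow[OF derivation, of g j "[:1:]"] times_X_pow_one[OF derivation, of j]
  by simp

lemma monom_mult_monom: "monom 1 i \<star> monom c j = monom c (i + j)"
proof -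
  have "monom 1 i \<star> monom 1 j = monom 1 (i + j)" for i j
  proof -
    have "monom 1 i \<star> monom 1 j = (times_X D ^^ j) ((times_X D ^^ i) [:1:])"
      by (simp only: times_X_pow_eq skew_mult_one_left)
    then show ?thesis
      by (metis add.commute comp_apply funpow_add times_X_pow_one[OF derivation])
  qed
  then show ?thesis
    by (metis skew_assoc skew_mult_monom_const[OF derivation])
qed

lemma monom_eq: "monom c k = monom 1 k \<star> [:c:]"
  by (simp add: skew_mult_monom_const[OF derivation])

lemma pCons_eq: "pCons c g = [:c:] + X \<star> g"
proof -
  have "X \<star> g = X \<star> (\<Sum>j\<le>degree g. monom (coeff g j) j)"
    by (simp only: poly_as_sum_of_monoms)
  also have "\<dots> = (\<Sum>j\<le>degree g. X \<star> monom (coeff g j) j)"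
    by (rule skew_mult_sum_right)
  also have "\<dots> = (\<Sum>j\<le>degree g. pCons 0 (monom (coeff g j) j))"
    by (simp add: monom_mult_monom) (simp add: monom_Suc)
  also have "\<dots> = pCons 0 (\<Sum>j\<le>degree g. monom (coeff g j) j)"
    by (rule poly_eqI) (simp add: coeff_sum coeff_pCons split: nat.splits)
  also have "\<dots> = pCons 0 g"
    by (simp add: poly_as_sum_of_monoms)
  finally show ?thesis by simp
qed

text \<open>
  The coefficientwise derivation is inner on \<open>B[X;D]\<close>: it measures the failure of \<open>X\<close> to commute.
\<close>

lemma map_poly_D_eq: "map_poly D g = g \<star> X - X \<star> g"
  using times_X_eq[of g] pCons_eq[of 0 g] by (simp add: times_X_def eq_diff_eq add.commute)

text \<open>
  The value \<open>\<Sum>i<n. X\<^sup>i u X\<^bsup>n-1-i\<^esup>\<close> that the Leibniz rule forces upon the derivative of \<open>X\<^sup>n\<close> when the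
  derivative of \<open>X\<close> is \<open>u\<close>.
\<close>

primrec power_deriv :: "'a poly \<Rightarrow> nat \<Rightarrow> 'a poly" where
  "power_deriv u 0 = 0"
| "power_deriv u (Suc n) = power_deriv u n \<star> X + monom 1 n \<star> u"

text \<open>
  Writing \<open>L\<close>, \<open>R\<close> for left and right multiplication by \<open>X\<close> and \<open>E = R - L\<close> for the coefficientwise
  derivation, this is \<open>(R\<^sup>n - L\<^sup>n)/(R - L) = ((L + E)\<^sup>n - L\<^sup>n)/E\<close> expanded by the binomial theorem.
\<close>

lemma power_deriv_binomial:
  "power_deriv u n =
    (\<Sum>k<n. times_const (monom 1 (n - 1 - k) \<star> (map_poly D ^^ k) u) (of_nat (n choose Suc k)))"
proof (induction n)
  case (Suc n)
  define M where "M i k = monom 1 i \<star> (map_poly D ^^ k) u" for i k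
  \<comment> \<open>This is \<open>R = L + E\<close>; as \<open>E\<close> commutes with \<open>L\<close>, the induction step is Pascal's rule.\<close>
  have mono: "M i k \<star> X = M (Suc i) k + M i (Suc k)" for i k
  proof -
    have "M i k \<star> X = monom 1 i \<star> (X \<star> (map_poly D ^^ k) u + (map_poly D ^^ Suc k) u)"
      by (simp add: M_def skew_assoc map_poly_D_eq)
    also have "\<dots> = M (Suc i) k + M i (Suc k)"
      by (simp only: skew_mult_add_right flip: skew_assoc) (simp add: M_def monom_mult_monom)
    finally show ?thesis .
  qed
  have scal: "times_const g (of_nat c) \<star> X = times_const (g \<star> X) (of_nat c)" for g c
    using times_X_times_const[OF derivation, of g "of_nat c"] by (simp add: times_X_eq D_of_nat)
  have "power_deriv u (Suc n)
      = (\<Sum>k<n. times_const (M (Suc (n - 1 - k)) k) (of_nat (n choose Suc k)))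
        + ((\<Sum>k<n. times_const (M (n - 1 - k) (Suc k)) (of_nat (n choose Suc k))) + M n 0)"
    using Suc[folded M_def]
    by (simp add: sum_skew_mult scal mono times_const_add sum.distrib add.assoc) (simp add: M_def)
  \<comment> \<open>The added summand \<open>k = n\<close> is zero because \<open>n choose Suc n = 0\<close>.\<close>
  also have "(\<Sum>k<n. times_const (M (Suc (n - 1 - k)) k) (of_nat (n choose Suc k)))
      = (\<Sum>k<Suc n. times_const (M (n - k) k) (of_nat (n choose Suc k)))"
    by (simp add: Suc_diff_Suc binomial_eq_0)
  also have "(\<Sum>k<n. times_const (M (n - 1 - k) (Suc k)) (of_nat (n choose Suc k))) + M n 0
      = (\<Sum>k<Suc n. times_const (M (n - k) k) (of_nat (n choose k)))"
    by (subst sum.lessThan_Suc_shift) (simp add: add.commute)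
  finally show ?case
    by (simp add: sum.distrib times_const_add_right add_ac flip: M_def)
qed simp

text \<open>
  In characteristic \<open>p\<close> only the last term of the binomial expansion survives for \<open>n = p\<^sup>j\<close>.
\<close>

lemma power_deriv_prime_power:
  assumes "prime p" "CHAR('a) = p"
  shows "power_deriv u (p ^ j) = (map_poly D ^^ (p ^ j - 1)) u"
proof -
  have pos: "p ^ j > 0"
    using assms(1) by (simp add: prime_gt_0_nat)
  have van: "of_nat (p ^ j choose k) = (0 :: 'a)" if "0 < k" "k < p ^ j" for k
  proof -
    have "p dvd (p ^ j choose k)"
    proof (rule ccontr)
      assume "\<not> p dvd (p ^ j choose k)"
      then have "coprime (p ^ j) (p ^ j choose k)"
        using assms(1) by (simp add: prime_imp_coprime)
      moreover have "k * (p ^ j choose k) = p ^ j * (p ^ j - 1 choose (k - 1))"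
        using that pos by (metis Suc_diff_1 Suc_times_binomial_eq mult.commute)
      ultimately have "p ^ j dvd k"
        by (metis coprime_dvd_mult_left_iff dvd_triv_left)
      with that show False by (auto dest: dvd_imp_le)
    qed
    then show ?thesis
      using assms(2) by (simp add: of_nat_eq_0_iff_char_dvd)
  qed
  obtain m where m: "p ^ j = Suc m"
    using pos by (cases "p ^ j") auto
  have "times_const (monom 1 (Suc m - 1 - k) \<star> (map_poly D ^^ k) u) (of_nat (Suc m choose Suc k)) = 0"
    if "k < m" for k
    using van[of "Suc k"] that by (simp add: m del: binomial_Suc_Suc)
  then have "(\<Sum>k<m. times_const (monom 1 (Suc m - 1 - k) \<star> (map_poly D ^^ k) u)
      (of_nat (Suc m choose Suc k))) = 0"
    by (intro sum.neutral) auto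
  then show ?thesis
    by (simp add: m power_deriv_binomial monom_0 del: binomial_Suc_Suc power_deriv.simps)
qed

text \<open>
  This map is additive and right \<open>B\<close>-linear for every \<open>u\<close>.  The Leibniz rule holds only modulo
  two-sided ideals modulo which \<open>u\<close> commutes with \<open>B\<close>.
\<close>

definition formal_deriv :: "'a poly \<Rightarrow> 'a poly \<Rightarrow> 'a poly" where
  "formal_deriv u g = (\<Sum>k\<le>degree g. times_const (power_deriv u k) (coeff g k))"

lemma formal_deriv_bound:
  assumes "degree g \<le> n"
  shows "formal_deriv u g = (\<Sum>k\<le>n. times_const (power_deriv u k) (coeff g k))"
  unfolding formal_deriv_def using assms
  by (intro sum.mono_neutral_left) (auto simp: coeff_eq_0)

lemma formal_deriv_add: "formal_deriv u (g + h) = formal_deriv u g + formal_deriv u h"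
proof -
  let ?n = "max (degree g) (degree h)"
  have "degree (g + h) \<le> ?n" by (rule degree_add_le_max)
  then show ?thesis
    by (simp add: formal_deriv_bound[of _ ?n] times_const_add_right sum.distrib)
qed

lemma formal_deriv_0 [simp]: "formal_deriv u 0 = 0"
  by (simp add: formal_deriv_def)

lemma formal_deriv_sum: "formal_deriv u (\<Sum>i\<in>I. g i) = (\<Sum>i\<in>I. formal_deriv u (g i))"
  by (induction I rule: infinite_finite_induct) (simp_all add: formal_deriv_add)

lemma formal_deriv_times_const: "formal_deriv u (times_const g c) = times_const (formal_deriv u g) c"
proof -
  have "degree (times_const g c) \<le> degree g"
    by (rule degree_le) (simp add: coeff_eq_0)
  then show ?thesis
    by (simp add: formal_deriv_bound[of _ "degree g"] times_const_sum times_const_times_const)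
qed

lemma formal_deriv_monom: "formal_deriv u (monom c k) = times_const (power_deriv u k) c"
proof -
  have "formal_deriv u (monom c k)
      = (\<Sum>i\<le>k. times_const (power_deriv u i) (coeff (monom c k) i))"
    by (rule formal_deriv_bound) (rule degree_monom_le)
  also have "\<dots> = (\<Sum>i\<in>{k}. times_const (power_deriv u i) (coeff (monom c k) i))"
    by (rule sum.mono_neutral_right) auto
  finally show ?thesis by simp
qed

lemma formal_deriv_const [simp]: "formal_deriv u [:c:] = 0"
  by (simp add: formal_deriv_def)

lemma formal_deriv_X [simp]: "formal_deriv u X = u"
  by (simp add: formal_deriv_monom monom_0)

lemma formal_deriv_p_poly:
  assumes "prime p" "CHAR('a) = p"
  shows "formal_deriv u (p_poly p e b)
    = (\<Sum>j\<le>e. times_const ((map_poly D ^^ (p ^ j - 1)) u) (b (j + 1)))"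
  by (simp add: p_poly_def formal_deriv_add formal_deriv_sum formal_deriv_monom
      power_deriv_prime_power[OF assms])

text \<open>
  The defect of the Leibniz rule for \<open>g X\<close>: the right-hand side becomes \<open>g u\<close> as soon as \<open>u\<close> can be
  moved past the coefficients of \<open>g\<close>.  The terms \<open>X\<^sup>k D(c\<^sub>k)\<close> of \<open>g X\<close> contribute equally to both
  summands on the left and cancel.
\<close>

lemma formal_deriv_times_X:
  "formal_deriv u (g \<star> X) - formal_deriv u g \<star> X
    = (\<Sum>k\<le>degree g. monom 1 k \<star> u \<star> [:coeff g k:])"
proof -
  have one: "formal_deriv u (monom c k \<star> X) - formal_deriv u (monom c k) \<star> X
      = monom 1 k \<star> u \<star> [:c:]" for c k
  proof -
    have a: "monom c k \<star> X = monom c (Suc k) + monom (D c) k"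
    proof -
      have "monom c k \<star> X = monom 1 k \<star> ([:c:] \<star> X)"
        by (simp flip: skew_assoc add: skew_mult_monom_const[OF derivation])
      also have "[:c:] \<star> X = monom c 1 + [:D c:]"
        using skew_commutation[OF derivation, of c] by simp
      finally show ?thesis
        by (simp add: skew_mult_add_right monom_mult_monom skew_mult_monom_const[OF derivation])
    qed
    have b: "times_const g c \<star> X = times_const (g \<star> X) c + times_const g (D c)" for g
      using times_X_times_const[OF derivation, of g c] by (simp add: times_X_eq)
    show ?thesis
      by (simp add: a b formal_deriv_add formal_deriv_monom times_const_add skew_mult_const_right)
  qed
  have "formal_deriv u (g \<star> X) - formal_deriv u g \<star> X =
      formal_deriv u ((\<Sum>k\<le>degree g. monom (coeff g k) k) \<star> X)
      - formal_deriv u (\<Sum>k\<le>degree g. monom (coeff g k) k) \<star> X"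
    by (simp only: poly_as_sum_of_monoms)
  also have "\<dots> = (\<Sum>k\<le>degree g. monom 1 k \<star> u \<star> [:coeff g k:])"
    unfolding sum_skew_mult formal_deriv_sum by (simp flip: sum_subtractf add: one)
  finally show ?thesis .
qed

end

section \<open>Residue classes modulo a monic two-sided generator\<close>

locale skew_quotient = skew_polynomials D for D :: "'a::ring_1 \<Rightarrow> 'a" +
  fixes f :: "'a poly"
  assumes f_in: "f \<in> skew_poly_ring_0 D"
begin

abbreviation A :: "'a poly set ring" where
  "A \<equiv> skew_ext D f"

abbreviation cls :: "'a poly \<Rightarrow> 'a poly set" where
  "cls \<equiv> skew_class D f"

lemma skew_ideal_right: "skew_ideal D f = range (\<lambda>g. f \<star> g)"
  by (auto simp: skew_ideal_def l_coset_def skew_poly_ring_def)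

lemma skew_ideal_left: "skew_ideal D f = range (\<lambda>g. g \<star> f)"
  using f_in by (auto simp: skew_ideal_def skew_poly_ring_0_def r_coset_def skew_poly_ring_def)

lemma lead_coeff_f: "lead_coeff f = 1"
  using f_in by (simp add: skew_poly_ring_0_def)

lemma ideal_add: "g \<in> skew_ideal D f \<Longrightarrow> h \<in> skew_ideal D f \<Longrightarrow> g + h \<in> skew_ideal D f"
  unfolding skew_ideal_right by (auto simp flip: skew_mult_add_right)

lemma ideal_uminus: "g \<in> skew_ideal D f \<Longrightarrow> - g \<in> skew_ideal D f"
  unfolding skew_ideal_right by (auto simp flip: skew_mult_uminus_right)

lemma ideal_0: "0 \<in> skew_ideal D f"
  unfolding skew_ideal_right by (auto intro: range_eqI[of _ _ 0])

lemma ideal_mult_right: "g \<in> skew_ideal D f \<Longrightarrow> g \<star> h \<in> skew_ideal D f"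
  unfolding skew_ideal_right by (auto simp: skew_assoc)

lemma ideal_mult_left: "g \<in> skew_ideal D f \<Longrightarrow> h \<star> g \<in> skew_ideal D f"
  unfolding skew_ideal_left by (auto simp flip: skew_assoc)

lemma a_inv_R: "\<ominus>\<^bsub>skew_poly_ring D\<^esub> g = - g"
proof -
  interpret R: ring "skew_poly_ring D" by (rule ring_R)
  show ?thesis
    by (rule R.minus_equality) (simp_all add: skew_poly_ring_def)
qed

lemma ideal_skew_ideal: "ideal (skew_ideal D f) (skew_poly_ring D)"
proof (rule idealI[OF ring_R])
  interpret R: ring "skew_poly_ring D" by (rule ring_R)
  show "subgroup (skew_ideal D f) (add_monoid (skew_poly_ring D))"
  proof (rule R.add.subgroupI)
    show "skew_ideal D f \<noteq> {}" using ideal_0 by auto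
    show "\<ominus>\<^bsub>skew_poly_ring D\<^esub> g \<in> skew_ideal D f" if "g \<in> skew_ideal D f" for g
      using that by (simp add: a_inv_R ideal_uminus)
  qed (simp_all add: skew_poly_ring_def ideal_add)
qed (simp_all add: skew_poly_ring_def ideal_mult_left ideal_mult_right)

text \<open>
  Both one-sided descriptions of the ideal enter here; from now on, identities between skew
  polynomials can be read in \<open>A\<close>.
\<close>

lemma cls_hom: "ring_hom_ring (skew_poly_ring D) A cls"
  using ideal.rcos_ring_hom_ring[OF ideal_skew_ideal]
  by (simp add: skew_ext_def skew_class_def[abs_def])

lemma ring_A: "ring A"
  using cls_hom by (rule ring_hom_ring.axioms)

lemma cls_closed [simp]: "cls g \<in> carrier A"
  using ring_hom_closed[OF ring_hom_ring.homh[OF cls_hom], of g] by (simp add: skew_poly_ring_def)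

lemma cls_add: "cls (g + h) = cls g \<oplus>\<^bsub>A\<^esub> cls h"
  using ring_hom_add[OF ring_hom_ring.homh[OF cls_hom], of g h] by (simp add: skew_poly_ring_def)

lemma cls_mult: "cls (g \<star> h) = cls g \<otimes>\<^bsub>A\<^esub> cls h"
  using ring_hom_mult[OF ring_hom_ring.homh[OF cls_hom], of g h] by (simp add: skew_poly_ring_def)

lemma cls_mem_iff: "h \<in> cls g \<longleftrightarrow> h - g \<in> skew_ideal D f"
  by (auto simp: skew_class_def a_r_coset_defs skew_poly_ring_def algebra_simps
      intro!: bexI[of _ "h - g"])

lemma cls_eq_iff: "cls g = cls h \<longleftrightarrow> g - h \<in> skew_ideal D f"
proof
  assume "cls g = cls h"
  then show "g - h \<in> skew_ideal D f"
    using cls_mem_iff[of g g] cls_mem_iff[of g h] by (simp add: ideal_0)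
next
  assume *: "g - h \<in> skew_ideal D f"
  have "k - g \<in> skew_ideal D f \<longleftrightarrow> k - h \<in> skew_ideal D f" for k
    using ideal_add[OF _ *, of "k - g"] ideal_add[OF _ ideal_uminus[OF *], of "k - h"]
    by (auto simp: algebra_simps)
  then show "cls g = cls h"
    by (auto simp: cls_mem_iff)
qed

lemma cls_0: "cls 0 = \<zero>\<^bsub>A\<^esub>"
  by (auto simp: cls_mem_iff skew_ext_def FactRing_def)

lemma cls_f: "cls f = \<zero>\<^bsub>A\<^esub>"
  unfolding cls_0[symmetric] cls_eq_iff skew_ideal_right by (auto intro: range_eqI[of _ _ "[:1:]"])

lemma cls_diff: "cls (g - h) = cls g \<ominus>\<^bsub>A\<^esub> cls h"
proof -
  interpret A: ring A by (rule ring_A)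
  have "cls g = cls (g - h) \<oplus>\<^bsub>A\<^esub> cls h" by (simp flip: cls_add)
  then show ?thesis by (simp add: A.minus_eq A.a_assoc A.r_neg)
qed

lemma carrier_A: "carrier A = range cls"
  by (auto simp: skew_ext_def FactRing_def A_RCOSETS_def RCOSETS_def a_r_coset_def
      skew_class_def skew_poly_ring_def)

lemma cls_add_cong: "cls g = cls g' \<Longrightarrow> cls h = cls h' \<Longrightarrow> cls (g + h) = cls (g' + h')"
  by (simp add: cls_add)

lemma cls_mult_cong: "cls g = cls g' \<Longrightarrow> cls h = cls h' \<Longrightarrow> cls (g \<star> h) = cls (g' \<star> h')"
  by (simp add: cls_mult)

lemma cls_sum_cong: "(\<And>k. k \<in> K \<Longrightarrow> cls (g k) = cls (h k)) \<Longrightarrow> cls (sum g K) = cls (sum h K)"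
  by (induction K rule: infinite_finite_induct) (simp_all add: cls_add)

lemma cls_sum: "finite K \<Longrightarrow> cls (sum g K) = (\<Oplus>\<^bsub>A\<^esub>k\<in>K. cls (g k))"
proof (induction K rule: finite_induct)
  interpret A: ring A by (rule ring_A)
  case empty
  show ?case by (simp add: cls_0)
next
  interpret A: ring A by (rule ring_A)
  case (insert k K)
  then show ?case by (simp add: cls_add)
qed


section \<open>The induced derivation\<close>

lemma times_X_pow_degree:
  "degree ((times_X D ^^ k) g) \<le> degree g + k \<and> coeff ((times_X D ^^ k) g) (degree g + k) = lead_coeff g"
proof (induction k)
  case (Suc k)
  let ?h = "(times_X D ^^ k) g"
  have z: "coeff ?h i = 0" if "i > degree g + k" for i
    using Suc that by (intro coeff_eq_0) auto
  have c: "coeff (times_X D ?h) (Suc i) = coeff ?h i + D (coeff ?h (Suc i))" for i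
    by (simp add: times_X_def coeff_map_D[OF derivation])
  have "degree (times_X D ?h) \<le> degree g + Suc k"
  proof (rule degree_le, intro allI impI)
    fix i assume "i > degree g + Suc k"
    then obtain i' where i': "i = Suc i'" "i' > degree g + k" by (cases i) auto
    show "coeff (times_X D ?h) i = 0"
      using i' by (simp add: c z derivation_0[OF derivation])
  qed
  moreover have "coeff (times_X D ?h) (degree g + Suc k) = lead_coeff g"
    using Suc z[of "Suc (degree g + k)"] by (simp add: c derivation_0[OF derivation])
  ultimately show ?case by simp
qed simp

lemma times_const_degree_le: "degree (times_const g c) \<le> degree g"
  by (rule degree_le) (simp add: coeff_eq_0)

lemma f_mult_monom: "f \<star> monom c k = times_const ((times_X D ^^ k) f) c"
  by (metis monom_eq skew_assoc skew_mult_const_right times_X_pow_eq)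

text \<open>
  Multiplication on the right by \<open>X\<close> keeps the leading coefficient, so the monic \<open>f\<close> multiplies leading
  coefficients by one even if \<open>B\<close> has zero divisors.
\<close>

lemma degree_le_multiple:
  assumes "q \<noteq> 0"
  shows "degree f \<le> degree (f \<star> q)"
proof -
  let ?m = "degree f + degree q"
  have "coeff ((times_X D ^^ j) f) ?m = 0" if "j < degree q" for j
    using times_X_pow_degree[of j f] that by (intro coeff_eq_0) auto
  then have "coeff (f \<star> q) ?m = (\<Sum>j\<in>{degree q}. coeff ((times_X D ^^ j) f) ?m * coeff q j)"
    unfolding skew_mult_def coeff_sum coeff_times_const by (intro sum.mono_neutral_right) auto
  also have "\<dots> = lead_coeff q"
    using times_X_pow_degree[of "degree q" f] by (simp add: lead_coeff_f)
  finally have "coeff (f \<star> q) ?m \<noteq> 0" using assms by simp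
  then show ?thesis by (auto dest: le_degree)
qed

text \<open>
  Division with remainder by the monic \<open>f\<close>; in degree zero no remainder could have smaller degree.
\<close>

lemma remainder_exists:
  assumes "degree f > 0"
  shows "\<exists>r. r \<in> cls g \<and> degree r < degree f"
proof (induction "degree g" arbitrary: g rule: less_induct)
  case less
  show ?case
  proof (cases "degree g < degree f")
    case True
    then show ?thesis using ideal_0 by (auto simp: cls_mem_iff intro!: exI[of _ g])
  next
    case False
    define k where "k = degree g - degree f"
    have k: "degree f + k = degree g" using False by (simp add: k_def)
    define h where "h = f \<star> monom (lead_coeff g) k"
    have h: "degree h \<le> degree g" "coeff h (degree g) = lead_coeff g"
      using times_X_pow_degree[of k f] times_const_degree_le[of "(times_X D ^^ k) f" "lead_coeff g"]
      by (auto simp: h_def f_mult_monom k lead_coeff_f)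
    have "degree (g - h) < degree g"
    proof -
      have "degree (g - h) \<le> degree g - 1"
      proof (rule degree_le, intro allI impI)
        fix i assume "i > degree g - 1"
        then have "i = degree g \<or> i > degree g" by auto
        then show "coeff (g - h) i = 0" using h by (auto simp: coeff_eq_0)
      qed
      moreover have "degree g > 0" using False assms by auto
      ultimately show ?thesis by linarith
    qed
    then obtain r where r: "r \<in> cls (g - h)" "degree r < degree f"
      using less by blast
    have "cls (g - h) = cls g"
      unfolding cls_eq_iff using ideal_uminus by (auto simp: h_def skew_ideal_right)
    with r show ?thesis by auto
  qed
qed

lemma remainder_unique:
  assumes "r \<in> cls g" "degree r < degree f" "s \<in> cls g" "degree s < degree f"
  shows "r = s"
proof -
  have "r - s \<in> skew_ideal D f"
    using ideal_add[of "r - g" "- (s - g)"] ideal_uminus[of "s - g"] assms by (simp add: cls_mem_iff)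
  then obtain q where q: "r - s = f \<star> q" by (auto simp: skew_ideal_right)
  have "degree (r - s) < degree f" using assms by (intro degree_diff_less) auto
  with q degree_le_multiple[of q] have "q = 0" by force
  with q show ?thesis by simp
qed

text \<open>
  The definition through the remainder does not depend on that choice, because the coefficientwise
  derivation is the commutator with \<open>X\<close> and hence preserves the two-sided ideal.
\<close>

lemma induced_deriv_cls:
  assumes "degree f > 0"
  shows "induced_deriv D f (cls g) = cls (map_poly D g)"
proof -
  obtain r where r: "r \<in> cls g" "degree r < degree f"
    using remainder_exists[OF assms] by blast
  then have "(THE r. r \<in> cls g \<and> degree r < degree f) = r"
    using remainder_unique by blast
  moreover have "cls r = cls g"
    using r by (simp add: cls_mem_iff cls_eq_iff)
  then have "cls (map_poly D r) = cls (map_poly D g)"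
    by (simp add: map_poly_D_eq cls_diff cls_mult)
  ultimately show ?thesis by (simp add: induced_deriv_def)
qed

lemma induced_deriv_pow_cls:
  assumes "degree f > 0"
  shows "(induced_deriv D f ^^ n) (cls g) = cls ((map_poly D ^^ n) g)"
  by (induction n) (simp_all add: induced_deriv_cls[OF assms])

text \<open>
  The map \<open>\<tau>\<close> is evaluation of the formal derivative at \<open>f\<close>: the exponents of \<open>f\<close> are powers of the
  characteristic, and its constant term has derivative zero.
\<close>

lemma tau_cls:
  assumes "degree f > 0" "prime p" "CHAR('a) = p" "f = p_poly p e b"
  shows "tau D p e b (cls u) = cls (formal_deriv u f)"
proof -
  have "tau D p e b (cls u)
      = (\<Oplus>\<^bsub>A\<^esub>j\<in>{..e}. cls (times_const ((map_poly D ^^ (p ^ j - 1)) u) (b (j + 1))))"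
    unfolding tau_def Let_def assms(4)[symmetric]
    by (simp add: induced_deriv_pow_cls[OF assms(1)] cls_mult flip: skew_mult_const_right)
  also have "\<dots> = cls (formal_deriv u f)"
    by (subst assms(4)) (simp only: formal_deriv_p_poly[OF assms(2,3)] cls_sum finite_atMost)
  finally show ?thesis .
qed


section \<open>Derivations over the base ring\<close>

lemma centralizer_cls_iff:
  "cls u \<in> base_centralizer D f \<longleftrightarrow> (\<forall>c. cls (u \<star> [:c:]) = cls ([:c:] \<star> u))"
  by (simp add: base_centralizer_def centralizer_def cls_mult)

text \<open>
  Derivations of \<open>A\<close> are handled through a map \<open>d\<close> on representatives; \<open>d\<close> itself need be additive and
  satisfy the Leibniz rule only modulo the ideal.
\<close>

lemma relative_derivation_iff:
  assumes "\<And>g. \<delta> (cls g) = cls (d g)"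
  shows "relative_derivation A (range (base_emb D f)) \<delta> \<longleftrightarrow>
    (\<forall>g h. cls (d (g + h)) = cls (d g + d h)) \<and>
    (\<forall>g h. cls (d (g \<star> h)) = cls (d g \<star> h + g \<star> d h)) \<and>
    (\<forall>c. cls (d [:c:]) = cls 0)"
  by (auto simp: relative_derivation_def carrier_A assms cls_0 simp flip: cls_add cls_mult)

lemma relative_derivation_lift:
  assumes "relative_derivation A (range (base_emb D f)) \<delta>"
  obtains d where "\<And>g. \<delta> (cls g) = cls (d g)"
    "\<And>g h. cls (d (g + h)) = cls (d g + d h)"
    "\<And>g h. cls (d (g \<star> h)) = cls (d g \<star> h + g \<star> d h)"
    "\<And>c. cls (d [:c:]) = cls 0"
proof -
  have "\<exists>d. \<delta> (cls g) = cls d" for g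
    using assms by (auto simp: relative_derivation_def carrier_A Pi_iff image_iff)
  then obtain d where "\<And>g. \<delta> (cls g) = cls (d g)" by metis
  with assms relative_derivation_iff[of \<delta> d] show ?thesis
    using that by blast
qed

lemma const_mult_X: "[:c:] \<star> X = X \<star> [:c:] + [:D c:]"
  using skew_commutation[OF derivation, of c] by (simp add: skew_mult_monom_const[OF derivation])

text \<open>
  Apply \<open>\<delta>\<close> to \<open>c x = x c + D(c)\<close>: as \<open>\<delta>\<close> vanishes on \<open>B\<close>, this leaves \<open>c \<delta>(x) = \<delta>(x) c\<close>.
\<close>

lemma derivation_X_centralizes:
  assumes "relative_derivation A (range (base_emb D f)) \<delta>"
  shows "\<delta> (cls X) \<in> base_centralizer D f"
proof -
  obtain d where d: "\<And>g. \<delta> (cls g) = cls (d g)"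
    "\<And>g h. cls (d (g + h)) = cls (d g + d h)"
    "\<And>g h. cls (d (g \<star> h)) = cls (d g \<star> h + g \<star> d h)"
    "\<And>c. cls (d [:c:]) = cls 0"
    using relative_derivation_lift[OF assms] by metis
  have "cls (d X \<star> [:c:]) = cls ([:c:] \<star> d X)" for c
  proof -
    interpret A: ring A by (rule ring_A)
    have "cls (d ([:c:] \<star> X)) = cls (d (X \<star> [:c:] + [:D c:]))"
      by (simp only: const_mult_X)
    then show ?thesis
      by (simp only: d cls_add) (simp add: d cls_mult cls_0)
  qed
  then show ?thesis
    by (simp only: d(1) centralizer_cls_iff) blast
qed

text \<open>
  The Leibniz rule is built up in the right factor: \<open>h = X\<close> is where \<open>u\<close> must commute with \<open>B\<close>,
  induction gives \<open>h = X\<^sup>j\<close>, right \<open>B\<close>-linearity gives monomials, and additivity the rest.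
\<close>

lemma formal_deriv_mult:
  assumes "cls u \<in> base_centralizer D f"
  shows "cls (formal_deriv u (g \<star> h)) = cls (formal_deriv u g \<star> h + g \<star> formal_deriv u h)"
proof -
  have comm: "cls (u \<star> [:c:]) = cls ([:c:] \<star> u)" for c
    using assms by (simp only: centralizer_cls_iff)
  have X_step: "cls (formal_deriv u (g \<star> X)) = cls (formal_deriv u g \<star> X + g \<star> u)" for g
  proof -
    have "cls (\<Sum>k\<le>degree g. monom 1 k \<star> u \<star> [:coeff g k:])
        = cls (\<Sum>k\<le>degree g. monom (coeff g k) k \<star> u)"
      by (rule cls_sum_cong)
        (simp only: monom_eq[of "coeff g _"] skew_assoc cls_mult_cong[OF refl comm])
    also have "(\<Sum>k\<le>degree g. monom (coeff g k) k \<star> u) = (\<Sum>k\<le>degree g. monom (coeff g k) k) \<star> u"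
      by (rule sum_skew_mult[symmetric])
    also have "\<dots> = g \<star> u"
      by (simp only: poly_as_sum_of_monoms)
    finally have "cls (formal_deriv u (g \<star> X) - formal_deriv u g \<star> X) = cls (g \<star> u)"
      by (simp only: formal_deriv_times_X)
    from cls_add_cong[OF this refl, of "formal_deriv u g \<star> X"] show ?thesis
      by (simp add: add.commute)
  qed
  have pow_step: "cls (formal_deriv u (g \<star> monom 1 j))
      = cls (formal_deriv u g \<star> monom 1 j + g \<star> power_deriv u j)" for j
  proof (induction j)
    case 0
    show ?case by (simp add: monom_0)
  next
    case (Suc j)
    have split: "monom 1 (Suc j) = monom 1 j \<star> X"
      by (simp add: monom_mult_monom)
    have "cls (formal_deriv u (g \<star> monom 1 (Suc j)))
        = cls (formal_deriv u (g \<star> monom 1 j) \<star> X + g \<star> monom 1 j \<star> u)"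
      unfolding split using X_step[of "g \<star> monom 1 j"] by (simp only: skew_assoc)
    also have "\<dots> = cls ((formal_deriv u g \<star> monom 1 j + g \<star> power_deriv u j) \<star> X + g \<star> monom 1 j \<star> u)"
      by (intro cls_add_cong cls_mult_cong Suc.IH refl)
    also have "\<dots> = cls (formal_deriv u g \<star> monom 1 (Suc j) + g \<star> power_deriv u (Suc j))"
      unfolding split
      by (simp add: skew_mult_add_left[OF derivation] skew_mult_add_right skew_assoc add.assoc)
    finally show ?case .
  qed
  define P where "P h \<longleftrightarrow> cls (formal_deriv u (g \<star> h)) = cls (formal_deriv u g \<star> h + g \<star> formal_deriv u h)"
    for h
  have P_monom: "P (monom c j)" for c j
  proof -
    have "formal_deriv u (g \<star> monom c j) = formal_deriv u (g \<star> monom 1 j) \<star> [:c:]"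
      by (simp only: monom_eq[of c] skew_mult_const_right skew_mult_times_const formal_deriv_times_const)
    then have "cls (formal_deriv u (g \<star> monom c j))
        = cls ((formal_deriv u g \<star> monom 1 j + g \<star> power_deriv u j) \<star> [:c:])"
      by (simp only: cls_mult_cong[OF pow_step refl])
    also have "(formal_deriv u g \<star> monom 1 j + g \<star> power_deriv u j) \<star> [:c:]
        = formal_deriv u g \<star> monom c j + g \<star> formal_deriv u (monom c j)"
      by (simp only: skew_mult_add_left[OF derivation] skew_assoc monom_eq[of c]
          skew_mult_const_right[of "power_deriv u j"])
        (simp only: formal_deriv_monom flip: monom_eq)
    finally show ?thesis by (simp only: P_def)
  qed
  have P_add: "P (h + k)" if "P h" "P k" for h k
    using cls_add_cong[OF that[unfolded P_def]]
    by (simp add: P_def skew_mult_add_right formal_deriv_add add_ac)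
  have "P 0" by (simp add: P_def)
  then have "P (\<Sum>j\<in>J. monom (coeff h j) j)" for J
    by (induction J rule: infinite_finite_induct) (simp_all add: P_monom P_add)
  from this[of "{..degree h}"] show ?thesis
    by (simp only: poly_as_sum_of_monoms P_def)
qed

text \<open>
  Both sides are derivations vanishing on \<open>B\<close> with the same value at \<open>x\<close>, and \<open>B\<close> and \<open>x\<close> generate
  \<open>A\<close>; the induction follows \<open>c + X g\<close>.
\<close>

lemma derivation_eq_formal_deriv:
  assumes "relative_derivation A (range (base_emb D f)) \<delta>" "\<delta> (cls X) = cls u"
  shows "\<delta> (cls g) = cls (formal_deriv u g)"
proof -
  obtain d where d: "\<And>g. \<delta> (cls g) = cls (d g)"
    "\<And>g h. cls (d (g + h)) = cls (d g + d h)"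
    "\<And>g h. cls (d (g \<star> h)) = cls (d g \<star> h + g \<star> d h)"
    "\<And>c. cls (d [:c:]) = cls 0"
    using relative_derivation_lift[OF assms(1)] by metis
  have u: "cls u \<in> base_centralizer D f"
    using derivation_X_centralizes[OF assms(1)] assms(2) by simp
  have dX: "cls (d X) = cls u" using assms(2) d(1) by simp
  have "cls (d g) = cls (formal_deriv u g)"
  proof (induction g rule: pCons_induct)
    case 0
    show ?case using d(4)[of 0] by simp
  next
    case (pCons c g)
    have "cls (d (pCons c g)) = cls (0 + (u \<star> g + X \<star> formal_deriv u g))"
      unfolding pCons_eq[of c g] d(2)
      by (intro cls_add_cong d(4)) (simp only: d(3), intro cls_add_cong cls_mult_cong dX refl pCons.IH)
    also have "\<dots> = cls (formal_deriv u [:c:] + formal_deriv u (X \<star> g))"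
      by (intro cls_add_cong) (simp_all add: formal_deriv_mult[OF u])
    finally show ?case
      by (simp only: pCons_eq[of c g] formal_deriv_add)
  qed
  with d(1) show ?thesis by simp
qed

text \<open>
  The formal derivative passes to the quotient: if \<open>\<Delta>\<^sub>u(f)\<close> is zero in \<open>A\<close>, the Leibniz rule makes
  \<open>\<Delta>\<^sub>u(f q) = \<Delta>\<^sub>u(f) q + f \<Delta>\<^sub>u(q)\<close> zero in \<open>A\<close> for every \<open>q\<close>.
\<close>

lemma derivation_exists:
  assumes "cls u \<in> base_centralizer D f" "cls (formal_deriv u f) = \<zero>\<^bsub>A\<^esub>"
  obtains \<delta> where "relative_derivation A (range (base_emb D f)) \<delta>" "\<delta> (cls X) = cls u"
proof -
  interpret A: ring A by (rule ring_A)
  define \<delta> where "\<delta> y = cls (formal_deriv u (SOME g. cls g = y))" for y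
  have \<delta>: "\<delta> (cls g) = cls (formal_deriv u g)" for g
  proof -
    define h where "h = (SOME h. cls h = cls g)"
    have "cls h = cls g" unfolding h_def by (rule someI) (rule refl)
    then obtain q where "h - g = f \<star> q" by (auto simp: cls_eq_iff skew_ideal_right)
    then have h: "h = g + f \<star> q" by (simp add: diff_eq_eq add.commute)
    have "cls (formal_deriv u (f \<star> q)) = \<zero>\<^bsub>A\<^esub>"
      by (simp add: formal_deriv_mult[OF assms(1)] cls_add cls_mult assms(2) cls_f)
    then have "cls (formal_deriv u h) = cls (formal_deriv u g)"
      by (simp add: h formal_deriv_add cls_add)
    then show ?thesis by (simp add: \<delta>_def h_def)
  qed
  have "relative_derivation A (range (base_emb D f)) \<delta>"
    by (subst relative_derivation_iff[where d = "formal_deriv u", OF \<delta>])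
      (simp add: formal_deriv_add formal_deriv_mult[OF assms(1)])
  moreover have "\<delta> (cls X) = cls u" by (simp add: \<delta>)
  ultimately show ?thesis by (rule that)
qed

lemma inner_is_relative_derivation:
  assumes "h \<in> base_centralizer D f"
  shows "relative_derivation A (range (base_emb D f)) (\<lambda>y. h \<otimes>\<^bsub>A\<^esub> y \<ominus>\<^bsub>A\<^esub> y \<otimes>\<^bsub>A\<^esub> h)"
proof -
  obtain w where w: "h = cls w"
    using assms by (auto simp: base_centralizer_def centralizer_def carrier_A)
  have comm: "cls (w \<star> [:c:] - [:c:] \<star> w) = cls 0" for c
    using assms unfolding w centralizer_cls_iff by (simp add: cls_eq_iff)
  have "w \<star> (g + k) - (g + k) \<star> w = (w \<star> g - g \<star> w) + (w \<star> k - k \<star> w)"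
    and "w \<star> (g \<star> k) - g \<star> k \<star> w = (w \<star> g - g \<star> w) \<star> k + g \<star> (w \<star> k - k \<star> w)" for g k
    by (simp_all add: skew_mult_add_left[OF derivation] skew_mult_add_right skew_mult_diff_left
        skew_mult_diff_right skew_assoc)
  with comm show ?thesis
    by (subst relative_derivation_iff[where d = "\<lambda>g. w \<star> g - g \<star> w"])
      (simp_all only: w cls_diff cls_mult, simp_all)
qed

text \<open>
  If \<open>\<delta>(x) = D~(h) = hx - xh\<close> with \<open>h \<in> V\<close>, then \<open>\<delta>\<close> and the inner derivation by \<open>h\<close> are
  \<open>B\<close>-derivations that agree at \<open>x\<close>, hence everywhere.  Conversely, an inner \<open>B\<close>-derivation comes from
  some \<open>h \<in> V\<close> because it vanishes on \<open>B\<close>.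
\<close>

lemma inner_derivation_iff:
  assumes "relative_derivation A (range (base_emb D f)) \<delta>" "degree f > 0"
  shows "inner_derivation A \<delta> \<longleftrightarrow> \<delta> (cls X) \<in> induced_deriv D f ` base_centralizer D f"
proof
  assume "inner_derivation A \<delta>"
  then obtain w where w: "\<And>g. \<delta> (cls g) = cls (w \<star> g - g \<star> w)"
    by (auto simp: inner_derivation_def carrier_A cls_diff cls_mult)
  have "cls (w \<star> [:c:] - [:c:] \<star> w) = cls 0" for c
    using assms(1) relative_derivation_iff[where d = "\<lambda>g. w \<star> g - g \<star> w", OF w] by blast
  then have "cls w \<in> base_centralizer D f"
    unfolding centralizer_cls_iff by (simp add: cls_eq_iff)
  moreover have "\<delta> (cls X) = induced_deriv D f (cls w)"
    by (simp add: w induced_deriv_cls[OF assms(2)] map_poly_D_eq)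
  ultimately show "\<delta> (cls X) \<in> induced_deriv D f ` base_centralizer D f" by blast
next
  assume "\<delta> (cls X) \<in> induced_deriv D f ` base_centralizer D f"
  then obtain h where h: "h \<in> base_centralizer D f" "\<delta> (cls X) = induced_deriv D f h" by blast
  then obtain w where w: "h = cls w"
    by (auto simp: base_centralizer_def centralizer_def carrier_A)
  define u where "u = map_poly D w"
  have X: "\<delta> (cls X) = cls u"
    by (simp add: h w induced_deriv_cls[OF assms(2)] u_def)
  have "h \<otimes>\<^bsub>A\<^esub> cls X \<ominus>\<^bsub>A\<^esub> cls X \<otimes>\<^bsub>A\<^esub> h = cls u"
    by (simp add: w u_def map_poly_D_eq cls_diff cls_mult)
  from derivation_eq_formal_deriv[OF inner_is_relative_derivation[OF h(1)] this]
  have "\<delta> y = h \<otimes>\<^bsub>A\<^esub> y \<ominus>\<^bsub>A\<^esub> y \<otimes>\<^bsub>A\<^esub> h" if "y \<in> carrier A" for y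
    using that derivation_eq_formal_deriv[OF assms(1) X] by (auto simp: carrier_A)
  then show "inner_derivation A \<delta>"
    unfolding inner_derivation_def using w by (intro bexI[of _ h]) auto
qed

lemma derivation_values_at_X:
  "{\<delta> (cls X) | \<delta>. relative_derivation A (range (base_emb D f)) \<delta>}
    = {cls u | u. cls u \<in> base_centralizer D f \<and> cls (formal_deriv u f) = \<zero>\<^bsub>A\<^esub>}"
proof (intro equalityI subsetI)
  fix y assume "y \<in> {\<delta> (cls X) | \<delta>. relative_derivation A (range (base_emb D f)) \<delta>}"
  then obtain \<delta> where \<delta>: "relative_derivation A (range (base_emb D f)) \<delta>" "y = \<delta> (cls X)"
    by blast
  have V: "y \<in> base_centralizer D f"
    using derivation_X_centralizes[OF \<delta>(1)] \<delta>(2) by simp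
  then obtain u where u: "y = cls u"
    by (auto simp: base_centralizer_def centralizer_def carrier_A)
  have fd: "\<delta> (cls g) = cls (formal_deriv u g)" for g
    using derivation_eq_formal_deriv[OF \<delta>(1)] \<delta>(2) u by simp
  have "cls (formal_deriv u f) = cls (formal_deriv u 0)"
    by (simp only: flip: fd) (simp add: cls_f cls_0)
  with V u show "y \<in> {cls u | u. cls u \<in> base_centralizer D f \<and> cls (formal_deriv u f) = \<zero>\<^bsub>A\<^esub>}"
    by (auto simp: cls_0)
next
  fix y assume "y \<in> {cls u | u. cls u \<in> base_centralizer D f \<and> cls (formal_deriv u f) = \<zero>\<^bsub>A\<^esub>}"
  then show "y \<in> {\<delta> (cls X) | \<delta>. relative_derivation A (range (base_emb D f)) \<delta>}"
    by (auto elim!: derivation_exists)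
qed

end

theorem theorem3p8:
  fixes D :: "'a::ring_1 \<Rightarrow> 'a"
    and p e :: nat
    and b :: "nat \<Rightarrow> 'a"
    and f :: "'a poly"
  assumes "prime p" and "CHAR('a) = p"
    and "derivation D"
    and "e \<ge> 1"
    and "b (e + 1) = 1"
    and "f = p_poly p e b"
    and "f \<in> skew_poly_ring_0 D"
  shows "weakly_separable_poly D f \<longleftrightarrow>
    {g \<in> base_centralizer D f. tau D p e b g = \<zero>\<^bsub>skew_ext D f\<^esub>}
      = induced_deriv D f ` base_centralizer D f"
proof -
  interpret skew_quotient D f
    using assms by unfold_locales auto
  have "coeff f (p ^ e) = (\<Sum>j\<le>e. if j = e then b (j + 1) else 0) + coeff [:b 0:] (p ^ e)"
    using prime_gt_1_nat[OF assms(1)]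
    by (simp add: assms(6) p_poly_def coeff_sum power_inject_exp)
  \<comment> \<open>The powers \<open>p ^ j\<close> are distinct and positive, so only \<open>j = e\<close> contributes to this coefficient.\<close>
  also have "\<dots> = 1"
    using prime_gt_0_nat[OF assms(1)] assms(5) by (simp add: coeff_pCons split: nat.split)
  finally have "coeff f (p ^ e) \<noteq> 0" by simp
  then have deg: "degree f > 0"
    using le_degree[of f "p ^ e"] prime_gt_0_nat[OF assms(1)]
    by (metis gr_zeroI le_zero_eq power_eq_0_iff less_irrefl)
  let ?der = "relative_derivation A (range (base_emb D f))"
  let ?V = "base_centralizer D f"
  have kernel: "{g \<in> ?V. tau D p e b g = \<zero>\<^bsub>A\<^esub>} = {\<delta> (cls X) | \<delta>. ?der \<delta>}"
  proof -
    have "?V \<subseteq> range cls"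
      by (auto simp: base_centralizer_def centralizer_def carrier_A)
    then show ?thesis
      unfolding derivation_values_at_X using tau_cls[OF deg assms(1,2,6)]
      by (auto simp del: Collect_mem_eq simp: subset_iff image_iff) (metis)+
  qed
  have image: "induced_deriv D f ` ?V \<subseteq> {\<delta> (cls X) | \<delta>. ?der \<delta>}"
  proof
    fix y assume "y \<in> induced_deriv D f ` ?V"
    then obtain h where h: "h \<in> ?V" "y = induced_deriv D f h" by blast
    then obtain w where w: "h = cls w"
      by (auto simp: base_centralizer_def centralizer_def carrier_A)
    have "y = h \<otimes>\<^bsub>A\<^esub> cls X \<ominus>\<^bsub>A\<^esub> cls X \<otimes>\<^bsub>A\<^esub> h"
      by (simp add: h w induced_deriv_cls[OF deg] map_poly_D_eq cls_diff cls_mult)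
    with inner_is_relative_derivation[OF h(1)] show "y \<in> {\<delta> (cls X) | \<delta>. ?der \<delta>}"
      by (intro CollectI exI[of _ "\<lambda>y. h \<otimes>\<^bsub>A\<^esub> y \<ominus>\<^bsub>A\<^esub> y \<otimes>\<^bsub>A\<^esub> h"] conjI)
  qed
  have "weakly_separable_poly D f \<longleftrightarrow> {\<delta> (cls X) | \<delta>. ?der \<delta>} \<subseteq> induced_deriv D f ` ?V"
    unfolding weakly_separable_poly_def weakly_separable_ext_def
    using inner_derivation_iff[OF _ deg] by blast
  with image show ?thesis
    unfolding kernel by blast
qed

end
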